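(* Let $(X_i,Y_i)$ be a benign datapoint and $(X_i',Y_i')$ an erroneous datapoint, let $\hat f$ be an estimated regression function, and let $\hat S_r(x,y)=|y-\hat f(x)|$, $$\hat S_a(x,y)=\frac{\hat S_r(x,y)}{\hat u(x)+\hat\sigma(x)},\qquad \hat S_g(x,y)=\frac{\hat S_r(x,y)}{\sqrt{\hat u(x)\hat\sigma(x)}},$$ where $\hat u$ and $\hat\sigma$ are the epistemic and aleatoric uncertainty estimates. (1) If $\hat u(X_i)+\hat\sigma(X_i)\ge \hat u(X_i')+\hat\sigma(X_i')$, then $$\mathbb{P}\big(\hat S_a(X_i,Y_i)<\hat S_a(X_i',Y_i')\big)\ge \mathbb{P}\big(\hat S_r(X_i,Y_i)<\hat S_r(X_i',Y_i')\big).$$ (2) If $\hat u(X_i)\hat\sigma(X_i)\ge \hat u(X_i')\hat\sigma(X_i')$, then $$\mathbb{P}\big(\hat S_g(X_i,Y_i)<\hat S_g(X_i',Y_i')\big)\ge \mathbb{P}\big(\hat S_r(X_i,Y_i)<\hat S_r(X_i',Y_i')\big).$$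
   Context: Setting: $f$ is the true (real-valued) regression function. A benign datapoint $(X_i,Y_i)$ satisfies $Y_i=f(X_i)+\epsilon_i(X_i)$ with regression noise $\epsilon_i$; an erroneous datapoint $(X_i',Y_i')$ satisfies $Y_i'=f(X_i')+\epsilon_i(X_i')+\epsilon_i^{\ast}(X_i')$ with an additional corruption error $\epsilon_i^{\ast}$. $\hat f$ is an estimator of $f$. The epistemic uncertainty estimate is $\hat u(x)=\sqrt{\widehat{\operatorname{Var}}(\hat f(x))}$, the standard deviation at $x$ of regressors fitted on bootstrap-resampled versions of the data. The aleatoric uncertainty estimate $\hat\sigma(x)$ is an estimate of $\mathbb{E}(|\hat f(X)-Y|\mid X=x,\hat f)$, produced by fitting a separate regressor to predict the size of the residuals from the covariates. Both are (possibly random) real-valued functions of $x$, assumed strictly positive at the points considered so that the scores are well defined; the hypotheses in (1) and (2) are understood to hold almost surely. *)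

theory Defs
  imports "HOL-Probability.Probability"
begin

text \<open>
  Random functions on the covariate space \<open>N\<close> (noise, estimators, uncertainty estimates) are
  jointly measurable, so that evaluating them at a random covariate yields a random variable.
\<close>

definition random_function :: "'w measure \<Rightarrow> 'x measure \<Rightarrow> ('w \<Rightarrow> 'x \<Rightarrow> real) \<Rightarrow> bool" where
  "random_function M N g \<longleftrightarrow> (\<lambda>(w, x). g w x) \<in> borel_measurable (M \<Otimes>\<^sub>M N)"

definition benign_datapoint ::
  "'w measure \<Rightarrow> 'x measure \<Rightarrow> ('x \<Rightarrow> real) \<Rightarrow> ('w \<Rightarrow> 'x \<Rightarrow> real) \<Rightarrow>
   ('w \<Rightarrow> 'x) \<Rightarrow> ('w \<Rightarrow> real) \<Rightarrow> bool" where
  "benign_datapoint M N f eps X Y \<longleftrightarrow>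
     X \<in> measurable M N \<and> Y \<in> borel_measurable M \<and>
     (AE w in M. Y w = f (X w) + eps w (X w))"

definition erroneous_datapoint ::
  "'w measure \<Rightarrow> 'x measure \<Rightarrow> ('x \<Rightarrow> real) \<Rightarrow> ('w \<Rightarrow> 'x \<Rightarrow> real) \<Rightarrow> ('w \<Rightarrow> 'x \<Rightarrow> real) \<Rightarrow>
   ('w \<Rightarrow> 'x) \<Rightarrow> ('w \<Rightarrow> real) \<Rightarrow> bool" where
  "erroneous_datapoint M N f eps eps_star X Y \<longleftrightarrow>
     X \<in> measurable M N \<and> Y \<in> borel_measurable M \<and>
     (AE w in M. Y w = f (X w) + eps w (X w) + eps_star w (X w))"

text \<open>
  \<open>d'\<close> is a possible outcome of drawing \<open>length d\<close> points from \<open>d\<close> with replacement; the law of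
  the draw is not prescribed.
\<close>

definition bootstrap_resample :: "('x \<times> real) list \<Rightarrow> ('x \<times> real) list \<Rightarrow> bool" where
  "bootstrap_resample d d' \<longleftrightarrow> length d' = length d \<and> set d' \<subseteq> set d"

text \<open>
  Standard deviation at \<open>x\<close> of the regressors \<open>g 0, \<dots>, g (B - 1)\<close>, i.e. the square root of
  their empirical variance with normalisation \<open>1 / B\<close>.
\<close>

definition epistemic_uncertainty :: "nat \<Rightarrow> (nat \<Rightarrow> 'x \<Rightarrow> real) \<Rightarrow> 'x \<Rightarrow> real" where
  "epistemic_uncertainty B g x =
     sqrt (measure_pmf.variance (pmf_of_set {..<B}) (\<lambda>b. g b x))"

definition residual_data :: "('x \<Rightarrow> real) \<Rightarrow> ('x \<times> real) list \<Rightarrow> ('x \<times> real) list" where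
  "residual_data fh d = map (\<lambda>(x, y). (x, \<bar>fh x - y\<bar>)) d"

definition S_r :: "('x \<Rightarrow> real) \<Rightarrow> 'x \<Rightarrow> real \<Rightarrow> real" where
  "S_r fh x y = \<bar>y - fh x\<bar>"

definition S_a :: "('x \<Rightarrow> real) \<Rightarrow> ('x \<Rightarrow> real) \<Rightarrow> ('x \<Rightarrow> real) \<Rightarrow> 'x \<Rightarrow> real \<Rightarrow> real" where
  "S_a fh u s x y = S_r fh x y / (u x + s x)"

definition S_g :: "('x \<Rightarrow> real) \<Rightarrow> ('x \<Rightarrow> real) \<Rightarrow> ('x \<Rightarrow> real) \<Rightarrow> 'x \<Rightarrow> real \<Rightarrow> real" where
  "S_g fh u s x y = S_r fh x y / sqrt (u x * s x)"

end

theory Submission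
  imports Defs
begin

text \<open>Both claims are one pointwise fact integrated over \<open>M\<close>. Suppose the benign
  residual is smaller than the erroneous one, and each is divided by a positive number, the benign
  one by a number at least as large. Then the strict order survives, so outside a null set the event
  for \<open>S_r\<close> is contained in the event for the scaled score, and monotonicity of the
  measure finishes. No independence or law of the noise enters. The pointwise fact is
  \<open>divide_strict_right_mono_denominators\<close>, its probabilistic form
  \<open>measure_less_le_measure_divide_less\<close>; the rest is measurability of the events, since
  \<open>measure\<close> is 0 by convention on sets that are not measurable.\<close>

lemma random_function_comp_measurable:
  assumes "random_function M N g" and "X \<in> measurable M N"
  shows "(\<lambda>w. g w (X w)) \<in> borel_measurable M"
proof -
  have "(\<lambda>w. (w, X w)) \<in> measurable M (M \<Otimes>\<^sub>M N)"
    using assms(2) by measurable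
  from measurable_compose[OF this assms(1)[unfolded random_function_def]]
  show ?thesis by simp
qed

text \<open>Turns the integral against the uniform law into finite sums, whose measurability can be
  derived term by term. \<open>B > 0\<close> makes the support nonempty, as
  \<open>pmf_of_set\<close> requires.\<close>

lemma epistemic_uncertainty_eq_sum:
  assumes "B > 0"
  shows "epistemic_uncertainty B g x =
    sqrt ((\<Sum>b<B. (g b x - (\<Sum>c<B. g c x) / real B)\<^sup>2) / real B)"
proof -
  have "{..<B} \<noteq> {}" using assms by auto
  then show ?thesis
    by (simp add: epistemic_uncertainty_def integral_pmf_of_set)
qed

lemma random_function_epistemic_uncertainty:
  assumes "B > 0" and "\<And>b. b < B \<Longrightarrow> random_function M N (\<lambda>w. g w b)"
  shows "random_function M N (\<lambda>w. epistemic_uncertainty B (g w))"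
proof -
  have [measurable]: "(\<lambda>z. g (fst z) b (snd z)) \<in> borel_measurable (M \<Otimes>\<^sub>M N)" if "b < B" for b
    using assms(2)[OF that] by (simp add: random_function_def case_prod_beta)
  show ?thesis
    unfolding random_function_def epistemic_uncertainty_eq_sum[OF assms(1)] case_prod_beta
    by measurable
qed

text \<open>The intermediate value is \<open>r / c'\<close>: shrinking the denominator cannot
  decrease a nonnegative quotient, and over the common positive denominator \<open>c'\<close> the
  strict order of the numerators is kept.\<close>

lemma divide_strict_right_mono_denominators:
  fixes r r' c c' :: real
  assumes "0 \<le> r" "r < r'" "0 < c'" "c' \<le> c"
  shows "r / c < r' / c'"
proof -
  have "r / c \<le> r / c'" using assms by (intro divide_left_mono) auto
  also have "\<dots> < r' / c'" using assms by (intro divide_strict_right_mono) auto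
  finally show ?thesis .
qed

lemma (in finite_measure) measure_less_le_measure_divide_less:
  fixes r r' c c' :: "'a \<Rightarrow> real"
  assumes [measurable]: "r \<in> borel_measurable M" "r' \<in> borel_measurable M"
      "c \<in> borel_measurable M" "c' \<in> borel_measurable M"
    and "\<And>w. 0 \<le> r w" and "AE w in M. 0 < c' w" and "AE w in M. c' w \<le> c w"
  shows "measure M {w \<in> space M. r w < r' w} \<le> measure M {w \<in> space M. r w / c w < r' w / c' w}"
proof (rule finite_measure_mono_AE)
  show "AE w in M. w \<in> {w \<in> space M. r w < r' w} \<longrightarrow> w \<in> {w \<in> space M. r w / c w < r' w / c' w}"
    using assms(6,7)
    by eventually_elim (auto intro: divide_strict_right_mono_denominators assms(5))
\<comment> \<open>Monotonicity up to null sets also asks that the larger event be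
  measurable.\<close>
qed measurable

theorem theorem4:
  fixes M :: "'w measure" and N :: "'x measure"
    and f :: "'x \<Rightarrow> real"
    and eps eps_star :: "'w \<Rightarrow> 'x \<Rightarrow> real"
    and X X' :: "'w \<Rightarrow> 'x" and Y Y' :: "'w \<Rightarrow> real"
    and f_hat u_hat sigma_hat :: "'w \<Rightarrow> 'x \<Rightarrow> real"
    and data :: "'w \<Rightarrow> ('x \<times> real) list"
    and B :: nat
    and boot_data :: "nat \<Rightarrow> 'w \<Rightarrow> ('x \<times> real) list"
    and fit :: "nat \<Rightarrow> 'w \<Rightarrow> ('x \<times> real) list \<Rightarrow> 'x \<Rightarrow> real"
    and fit_res :: "'w \<Rightarrow> ('x \<times> real) list \<Rightarrow> 'x \<Rightarrow> real"
  assumes "prob_space M"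
    and "f \<in> borel_measurable N"
    and "random_function M N eps" and "random_function M N eps_star"
    and "benign_datapoint M N f eps X Y"
    and "erroneous_datapoint M N f eps eps_star X' Y'"
    and "random_function M N f_hat"
    and "B > 0"
    and "\<And>b w. b < B \<Longrightarrow> w \<in> space M \<Longrightarrow> bootstrap_resample (data w) (boot_data b w)"
    and "\<And>b. b < B \<Longrightarrow> random_function M N (\<lambda>w. fit b w (boot_data b w))"
    and "\<And>w. u_hat w = epistemic_uncertainty B (\<lambda>b. fit b w (boot_data b w))"
    and "\<And>w. sigma_hat w = fit_res w (residual_data (f_hat w) (data w))"
    and "random_function M N sigma_hat"
    and "AE w in M. u_hat w (X w) > 0" and "AE w in M. u_hat w (X' w) > 0"
    and "AE w in M. sigma_hat w (X w) > 0" and "AE w in M. sigma_hat w (X' w) > 0"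
  shows
    "((AE w in M. u_hat w (X w) + sigma_hat w (X w) \<ge> u_hat w (X' w) + sigma_hat w (X' w)) \<longrightarrow>
        measure M {w \<in> space M. S_a (f_hat w) (u_hat w) (sigma_hat w) (X w) (Y w)
                              < S_a (f_hat w) (u_hat w) (sigma_hat w) (X' w) (Y' w)}
        \<ge> measure M {w \<in> space M. S_r (f_hat w) (X w) (Y w) < S_r (f_hat w) (X' w) (Y' w)})
     \<and>
     ((AE w in M. u_hat w (X w) * sigma_hat w (X w) \<ge> u_hat w (X' w) * sigma_hat w (X' w)) \<longrightarrow>
        measure M {w \<in> space M. S_g (f_hat w) (u_hat w) (sigma_hat w) (X w) (Y w)
                              < S_g (f_hat w) (u_hat w) (sigma_hat w) (X' w) (Y' w)}
        \<ge> measure M {w \<in> space M. S_r (f_hat w) (X w) (Y w) < S_r (f_hat w) (X' w) (Y' w)})"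
proof -
  interpret prob_space M by fact
  have [measurable]: "X \<in> measurable M N" "X' \<in> measurable M N"
    and [measurable]: "Y \<in> borel_measurable M" "Y' \<in> borel_measurable M"
    using assms(5,6) by (auto simp: benign_datapoint_def erroneous_datapoint_def)
  \<comment> \<open>Joint measurability of \<open>u_hat\<close> is inherited from the finitely many
    bootstrap regressors.\<close>
  have u: "random_function M N u_hat"
  proof -
    have "u_hat = (\<lambda>w. epistemic_uncertainty B (\<lambda>b. fit b w (boot_data b w)))"
      using assms(11) by blast
    then show ?thesis
      using random_function_epistemic_uncertainty[OF assms(8),
          of M N "\<lambda>w b. fit b w (boot_data b w)"] assms(10) by simp
  qed
  note [measurable] =
    random_function_comp_measurable[OF u \<open>X \<in> measurable M N\<close>]
    random_function_comp_measurable[OF u \<open>X' \<in> measurable M N\<close>]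
    random_function_comp_measurable[OF assms(13) \<open>X \<in> measurable M N\<close>]
    random_function_comp_measurable[OF assms(13) \<open>X' \<in> measurable M N\<close>]
    random_function_comp_measurable[OF assms(7) \<open>X \<in> measurable M N\<close>]
    random_function_comp_measurable[OF assms(7) \<open>X' \<in> measurable M N\<close>]
  have pos_sum: "AE w in M. 0 < u_hat w (X' w) + sigma_hat w (X' w)"
    using assms(15,17) by eventually_elim simp
  have pos_sqrt: "AE w in M. 0 < sqrt (u_hat w (X' w) * sigma_hat w (X' w))"
    using assms(15,17) by eventually_elim simp
  show ?thesis
    unfolding S_a_def S_g_def S_r_def
    \<comment> \<open>The denominators are the sum for \<open>S_a\<close> and the square root of the
      product for \<open>S_g\<close>; in the latter case the assumed comparison of products passes
      to the roots by monotonicity of \<open>sqrt\<close>.\<close>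
    by (intro conjI impI measure_less_le_measure_divide_less pos_sum pos_sqrt) (simp_all, measurable)
qed

end
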